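(* Let $\mathbb{F}$ be a field of characteristic not $2$. (1) Let $A$ be a Vidinli algebra over $\mathbb{F}$ with norm $q$, let $V=\{x\in A\mid q(x,1)=0\}$ be the orthogonal subspace to $\mathbb{F}1$ relative to the norm, and let $B\colon A\times A\to\mathbb{F}$ be the bilinear form of $A$, $B(x,y)=\frac12\bigl(q(x,y)-\omega(x,y)\bigr)$, where $\omega$ is defined by $[x,y]=\omega(x,y)1$. Then the multiplication in $A=\mathbb{F}1\oplus V$ is determined by the formula $$(\alpha 1+u)(\beta 1+v)=\bigl(\alpha\beta-B(u,v)\bigr)1+\bigl(\alpha v+\beta u\bigr)$$ for any $\alpha,\beta\in\mathbb{F}$ and $u,v\in V$. (2) Conversely, given any vector space $V$ over $\mathbb{F}$ endowed with a bilinear form $B\colon V\times V\to\mathbb{F}$, the vector space $\mathbb{F}1\oplus V$ becomes a Vidinli algebra with the multiplication $$(\alpha 1+u)(\beta 1+v)=\bigl(\alpha\beta-B(u,v)\bigr)1+\bigl(\alpha v+\beta u\bigr)\qquad(\alpha,\beta\in\mathbb{F},\ u,v\in V)$$ and the norm given by $q(\alpha 1+v)=\alpha^2+B(v,v)$ for any $\alpha\in\mathbb{F}$ and $v\in V$.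
   Context: Algebras are not necessarily associative: an algebra over a field $\mathbb{F}$ is a vector space with a bilinear multiplication (of arbitrary dimension). Write $[x,y]=xy-yx$. For a quadratic form $q$, its polar form is denoted by the same letter: $q(x,y)=q(x+y)-q(x)-q(y)$. A conic algebra is a unital algebra $A$ (unity $1$) endowed with a quadratic form $q\colon A\to\mathbb{F}$, called the norm, such that $q(1)=1$ and $x^2-q(x,1)x+q(x)1=0$ for all $x\in A$. A Vidinli algebra is a conic algebra $A$ such that $[A,A]\subseteq\mathbb{F}1$. If $\operatorname{char}\mathbb{F}\neq 2$ and $A$ is a Vidinli algebra with norm $q$, then $\omega\colon A\times A\to\mathbb{F}$ denotes the skew-symmetric bilinear form with $[x,y]=\omega(x,y)1$. Since $q(1,1)=2\neq0$, $A=\mathbb{F}1\oplus V$ with $V=\{x\in A\mid q(x,1)=0\}$. *)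

theory Defs
  imports "HOL-Analysis.Product_Vector"
begin

definition bilinear_map ::
    "('f::field \<Rightarrow> 'a::ab_group_add \<Rightarrow> 'a) \<Rightarrow> ('f \<Rightarrow> 'b::ab_group_add \<Rightarrow> 'b) \<Rightarrow>
     ('f \<Rightarrow> 'c::ab_group_add \<Rightarrow> 'c) \<Rightarrow> ('a \<Rightarrow> 'b \<Rightarrow> 'c) \<Rightarrow> bool" where
  "bilinear_map s1 s2 s3 f \<longleftrightarrow>
     (\<forall>x. Vector_Spaces.linear s2 s3 (\<lambda>y. f x y)) \<and>
     (\<forall>y. Vector_Spaces.linear s1 s3 (\<lambda>x. f x y))"

abbreviation bilinear_form ::
    "('f::field \<Rightarrow> 'a::ab_group_add \<Rightarrow> 'a) \<Rightarrow> ('a \<Rightarrow> 'a \<Rightarrow> 'f) \<Rightarrow> bool" where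
  "bilinear_form s b \<equiv> bilinear_map s s (*) b"

lemma vector_space_field: "vector_space ((*) :: 'f::field \<Rightarrow> 'f \<Rightarrow> 'f)"
  by (rule vector_space.intro) (simp_all add: distrib_left distrib_right mult.assoc)

definition polar :: "('a::ab_group_add \<Rightarrow> 'f::field) \<Rightarrow> 'a \<Rightarrow> 'a \<Rightarrow> 'f" where
  "polar q x y = q (x + y) - q x - q y"

definition quadratic_form ::
    "('f::field \<Rightarrow> 'a::ab_group_add \<Rightarrow> 'a) \<Rightarrow> ('a \<Rightarrow> 'f) \<Rightarrow> bool" where
  "quadratic_form s q \<longleftrightarrow> (\<forall>c x. q (s c x) = c\<^sup>2 * q x) \<and> bilinear_form s (polar q)"

definition (in module) internal_direct_sum :: "'b set \<Rightarrow> 'b set \<Rightarrow> bool" where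
  "internal_direct_sum U W \<longleftrightarrow>
     subspace U \<and> subspace W \<and> U \<inter> W = {0} \<and> {u + w | u w. u \<in> U \<and> w \<in> W} = UNIV"


text \<open>
  Algebras are not assumed to be associative. The underlying vector space is the whole type
  of its elements, with scalar multiplication \<open>scale\<close>; no dimension restriction is made.
\<close>

locale nonassoc_algebra = vector_space scale
  for scale :: "'f::field \<Rightarrow> 'a::ab_group_add \<Rightarrow> 'a" +
  fixes mult :: "'a \<Rightarrow> 'a \<Rightarrow> 'a"
  assumes mult_bilinear: "bilinear_map scale scale scale mult"
begin

definition commutator :: "'a \<Rightarrow> 'a \<Rightarrow> 'a" where
  "commutator x y = mult x y - mult y x"

end

locale unital_nonassoc_algebra = nonassoc_algebra scale mult
  for scale :: "'f::field \<Rightarrow> 'a::ab_group_add \<Rightarrow> 'a" and mult +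
  fixes one :: 'a
  assumes mult_one_left: "mult one x = x"
    and mult_one_right: "mult x one = x"

locale conic_algebra = unital_nonassoc_algebra scale mult one
  for scale :: "'f::field \<Rightarrow> 'a::ab_group_add \<Rightarrow> 'a" and mult one +
  fixes q :: "'a \<Rightarrow> 'f"
  assumes norm_quadratic: "quadratic_form scale q"
    and norm_one: "q one = 1"
    and conic: "mult x x - scale (polar q x one) x + scale (q x) one = 0"
begin

lemma one_nonzero: "one \<noteq> 0"
proof
  assume "one = 0"
  then have "scale 0 one = one" by simp
  moreover have "q (scale 0 one) = 0\<^sup>2 * q one"
    using norm_quadratic unfolding quadratic_form_def by blast
  ultimately show False using norm_one by simp
qed

definition one_perp :: "'a set" where
  "one_perp = {x. polar q x one = 0}"

end

text \<open>Here \<open>[A, A]\<close> is the linear span of all commutators.\<close>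

locale vidinli_algebra = conic_algebra scale mult one q
  for scale :: "'f::field \<Rightarrow> 'a::ab_group_add \<Rightarrow> 'a" and mult one q +
  assumes commutators_central: "span {commutator x y | x y. True} \<subseteq> span {one}"
begin

text \<open>
  The description in \<open>omega\<close> is justified by lemma \<open>commutator_eq_omega\<close>. The factor
  \<open>1 / 2\<close> in \<open>B_form\<close> is meaningful only in characteristic different from 2.
\<close>

definition omega :: "'a \<Rightarrow> 'a \<Rightarrow> 'f" where
  "omega x y = (THE c. commutator x y = scale c one)"

definition B_form :: "'a \<Rightarrow> 'a \<Rightarrow> 'f" where
  "B_form x y = 1 / 2 * (polar q x y - omega x y)"

lemma omega_unique:
  assumes "commutator x y = scale c one"
  shows "omega x y = c"
  unfolding omega_def using assms one_nonzero by (auto intro!: the_equality)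

lemma commutator_eq_omega: "commutator x y = scale (omega x y) one"
proof -
  have "commutator x y \<in> span {commutator x y | x y. True}"
    by (rule span_base) blast
  then have "commutator x y \<in> span {one}"
    using commutators_central by (rule rev_subsetD)
  then obtain c where c: "commutator x y = scale c one"
    unfolding span_singleton by (rule rangeE)
  then show ?thesis unfolding omega_unique[OF c] .
qed

lemma omega_skew: "omega y x = - omega x y"
proof (rule omega_unique)
  have "commutator y x = - commutator x y" by (simp add: commutator_def)
  also have "\<dots> = scale (- omega x y) one"
    unfolding commutator_eq_omega[of x y] by simp
  finally show "commutator y x = scale (- omega x y) one" .
qed

lemma omega_bilinear: "bilinear_form scale omega"
proof -
  have mr: "Vector_Spaces.linear scale scale (mult x)"
    and ml: "Vector_Spaces.linear scale scale (\<lambda>x. mult x y)" for x y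
    using mult_bilinear unfolding bilinear_map_def by blast+
  have lin: "mult x (y + z) = mult x y + mult x z" "mult (x + y) z = mult x z + mult y z"
    "mult x (scale c y) = scale c (mult x y)" "mult (scale c x) y = scale c (mult x y)" for x y z c
    using mr[of x] ml[of y] ml[of z] unfolding Vector_Spaces.linear_iff by blast+
  have add: "omega x (y + z) = omega x y + omega x z" for x y z
  proof (rule omega_unique)
    have "commutator x (y + z) = commutator x y + commutator x z"
      by (simp add: commutator_def lin)
    then show "commutator x (y + z) = scale (omega x y + omega x z) one"
      by (simp add: commutator_eq_omega scale_left_distrib)
  qed
  have scale: "omega x (scale c y) = c * omega x y" for x y c
  proof (rule omega_unique)
    have "commutator x (scale c y) = scale c (commutator x y)"
      by (simp add: commutator_def lin scale_right_diff_distrib)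
    then show "commutator x (scale c y) = scale (c * omega x y) one"
      by (simp add: commutator_eq_omega)
  qed
  have "Vector_Spaces.linear scale (*) (omega x)" for x
    unfolding Vector_Spaces.linear_iff using vector_space_field vector_space_axioms add scale by blast
  moreover have "Vector_Spaces.linear scale (*) (\<lambda>x. omega x y)" for y
  proof -
    have "omega (x + z) y = omega x y + omega z y" for x z
      unfolding omega_skew[of "x + z" y] omega_skew[of x y] omega_skew[of z y]
      by (simp add: add)
    moreover have "omega (scale c x) y = c * omega x y" for c x
      unfolding omega_skew[of "scale c x" y] omega_skew[of x y]
      by (simp add: scale)
    ultimately show ?thesis
      unfolding Vector_Spaces.linear_iff using vector_space_field vector_space_axioms by blast
  qed
  ultimately show ?thesis unfolding bilinear_map_def by blast
qed

lemma B_form_bilinear: "bilinear_form scale B_form"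
proof -
  have "bilinear_form scale (polar q)"
    using norm_quadratic unfolding quadratic_form_def by blast
  moreover have "Vector_Spaces.linear scale (*) (\<lambda>x. 1 / 2 * (f x - g x))"
    if "Vector_Spaces.linear scale (*) f" "Vector_Spaces.linear scale (*) g" for f g :: "'a \<Rightarrow> 'f"
  proof -
    have "h * (a + b - (c + d)) = h * (a - c) + h * (b - d)"
      and "h * (k * a - k * b) = k * (h * (a - b))" for a b c d h k :: 'f
      by (simp_all add: right_diff_distrib distrib_left mult.left_commute)
    then show ?thesis using that unfolding Vector_Spaces.linear_iff by (simp only: simp_thms)
  qed
  ultimately show ?thesis
    using omega_bilinear unfolding bilinear_map_def B_form_def by blast
qed

end


text \<open>
  The external direct sum \<open>F1 \<oplus> V\<close>, realised on pairs: \<open>(\<alpha>, v)\<close> stands for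
  \<open>\<alpha>1 + v\<close>, so the unity is \<open>(1, 0)\<close>.
\<close>

definition sum_scale ::
    "('f::field \<Rightarrow> 'v::ab_group_add \<Rightarrow> 'v) \<Rightarrow> 'f \<Rightarrow> 'f \<times> 'v \<Rightarrow> 'f \<times> 'v" where
  "sum_scale smul = module_prod.scale (*) smul"

lemma sum_scale_Pair:
  assumes "vector_space smul"
  shows "sum_scale smul c (\<alpha>, v) = (c * \<alpha>, smul c v)"
proof -
  interpret p: module_prod "(*)" smul
    using vector_space_field assms
    by (simp add: module_prod_def module_pair_def module_iff_vector_space)
  show ?thesis unfolding sum_scale_def by (rule p.scale_prod)
qed

definition sum_one :: "'f::field \<times> 'v::ab_group_add" where
  "sum_one = (1, 0)"

fun sum_mult ::
    "('f::field \<Rightarrow> 'v::ab_group_add \<Rightarrow> 'v) \<Rightarrow> ('v \<Rightarrow> 'v \<Rightarrow> 'f) \<Rightarrow>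
     'f \<times> 'v \<Rightarrow> 'f \<times> 'v \<Rightarrow> 'f \<times> 'v" where
  "sum_mult smul B (\<alpha>, u) (\<beta>, v) = (\<alpha> * \<beta> - B u v, smul \<alpha> v + smul \<beta> u)"

fun sum_norm :: "('v::ab_group_add \<Rightarrow> 'v \<Rightarrow> 'f::field) \<Rightarrow> 'f \<times> 'v \<Rightarrow> 'f" where
  "sum_norm B (\<alpha>, v) = \<alpha>\<^sup>2 + B v v"

end

theory Submission
  imports Defs
begin

text \<open>
  A conic algebra satisfies a quadratic equation in each element, so linearising that equation
  expresses the anticommutator \<open>xy + yx\<close> through the norm. On vectors \<open>u, v\<close> orthogonal to the
  unity only the term \<open>- q(u, v) 1\<close> survives (\<open>conic_algebra.anticommutator\<close>). In a Vidinli
  algebra the commutator is a scalar as well, namely \<open>\<omega>(u, v) 1\<close>. Adding the two and dividing by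
  \<open>2\<close> gives \<open>uv = - B(u, v) 1\<close> (\<open>vidinli_algebra.mult_one_perp\<close>), and bilinearity then determines
  all products as soon as \<open>A = F1 \<oplus> V\<close>. This decomposition holds because \<open>q(1, 1) = 2\<close> is
  invertible, so the non-isotropic vector \<open>1\<close> splits off orthogonally.

  In the converse direction everything is an explicit computation with pairs: the polar form of
  the norm is \<open>2\<alpha>\<beta> + B(u, v) + B(v, u)\<close>, so the trace \<open>q(x, 1)\<close> of \<open>\<alpha>1 + u\<close> is \<open>2\<alpha>\<close>; and the
  commutator of \<open>\<alpha>1 + u\<close> and \<open>\<beta>1 + v\<close> is \<open>(B(v, u) - B(u, v)) 1\<close>, because the \<open>V\<close>-component
  \<open>\<alpha>v + \<beta>u\<close> of the product is symmetric.
\<close>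

lemma two_neq_zero_if_CHAR_neq_2:
  assumes "CHAR('f::field) \<noteq> 2"
  shows "(2 :: 'f) \<noteq> 0"
proof
  assume "(2 :: 'f) = 0"
  then have "of_nat 2 = (0 :: 'f)" by simp
  then have "CHAR('f) dvd 2" unfolding of_nat_eq_0_iff_char_dvd .
  then have "CHAR('f) \<le> 2"
    by (rule dvd_imp_le) simp
  moreover have "CHAR('f) \<noteq> 0"
    using \<open>CHAR('f) dvd 2\<close> by (metis dvd_0_left zero_neq_numeral)
  moreover have "CHAR('f) \<noteq> Suc 0"
    by (rule CHAR_not_1)
  ultimately show False using assms by linarith
qed

lemma bilinear_map_iff:
  "bilinear_map s1 s2 s3 f \<longleftrightarrow>
     vector_space s1 \<and> vector_space s2 \<and> vector_space s3 \<and>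
     (\<forall>x y z. f x (y + z) = f x y + f x z) \<and> (\<forall>x y z. f (x + y) z = f x z + f y z) \<and>
     (\<forall>c x y. f x (s2 c y) = s3 c (f x y)) \<and> (\<forall>c x y. f (s1 c x) y = s3 c (f x y))"
  unfolding bilinear_map_def Vector_Spaces.linear_iff by blast

section \<open>Products in a Vidinli algebra\<close>

context nonassoc_algebra
begin

lemma mult_linear:
  "mult x (y + z) = mult x y + mult x z"
  "mult (x + y) z = mult x z + mult y z"
  "mult x (scale c y) = scale c (mult x y)"
  "mult (scale c x) y = scale c (mult x y)"
  using mult_bilinear unfolding bilinear_map_iff by blast+

end

context conic_algebra
begin

lemma polar_linear_left:
  "polar q (x + y) z = polar q x z + polar q y z"
  "polar q (scale c x) y = c * polar q x y"
  using norm_quadratic unfolding quadratic_form_def bilinear_map_iff by blast+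

lemma polar_one_one: "polar q one one = 2"
proof -
  have "q (scale 2 one) = 2\<^sup>2 * q one"
    using norm_quadratic unfolding quadratic_form_def by blast
  moreover have "scale 2 one = one + one"
    using scale_left_distrib[of 1 1 one] by simp
  ultimately show ?thesis
    by (simp add: polar_def norm_one power2_eq_square)
qed

text \<open>
  Expanding the conic equation of \<open>x + y\<close> and subtracting those of \<open>x\<close> and \<open>y\<close> leaves exactly the
  mixed terms.
\<close>

lemma anticommutator:
  "mult x y + mult y x =
     scale (polar q x one) y + scale (polar q y one) x - scale (polar q x y) one"
proof -
  have square: "mult z z = scale (polar q z one) z - scale (q z) one" for z
    using conic[of z] by (simp add: algebra_simps eq_neg_iff_add_eq_0)
  have "mult x y + mult y x = mult (x + y) (x + y) - mult x x - mult y y"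
    by (simp add: mult_linear)
  moreover have "q (x + y) = polar q x y + q x + q y"
    by (simp add: polar_def)
  ultimately show ?thesis
    unfolding square by (simp add: polar_linear_left algebra_simps)
qed

lemma one_perp_decomposition:
  assumes "(2 :: 'f) \<noteq> 0"
  shows "internal_direct_sum (span {one}) one_perp"
proof -
  have subspace_perp: "subspace one_perp"
    by (rule subspaceI)
      (use polar_linear_left(2)[of 0 one one] in
        \<open>auto simp: one_perp_def polar_linear_left\<close>)
  have "x = 0" if "x \<in> span {one}" "x \<in> one_perp" for x
    using that assms
    by (auto simp: span_singleton one_perp_def polar_linear_left polar_one_one)
  then have trivial: "span {one} \<inter> one_perp = {0}"
    using subspace_0[OF subspace_span] subspace_0[OF subspace_perp] by blast
  have "x \<in> {u + w | u w. u \<in> span {one} \<and> w \<in> one_perp}" for x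
  proof -
    \<comment> \<open>The orthogonal projection to \<open>F1\<close> has coefficient \<open>q(x, 1) / q(1, 1)\<close>.\<close>
    let ?u = "scale (polar q x one / 2) one"
    have "polar q (x + scale (- (polar q x one / 2)) one) one = 0"
      unfolding polar_linear_left polar_one_one using assms by simp
    then have "x - ?u \<in> one_perp"
      by (simp add: one_perp_def)
    moreover have "?u \<in> span {one}"
      unfolding span_singleton by (rule rangeI)
    moreover have "x = ?u + (x - ?u)"
      by simp
    ultimately show ?thesis by blast
  qed
  then show ?thesis
    unfolding internal_direct_sum_def using subspace_span subspace_perp trivial by blast
qed

end

context vidinli_algebra
begin

text \<open>
  The product is half the sum of anticommutator and commutator, and for vectors orthogonal to the
  unity both are scalars.
\<close>

lemma mult_one_perp:
  assumes "(2 :: 'f) \<noteq> 0" and "u \<in> one_perp" and "v \<in> one_perp"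
  shows "mult u v = scale (- B_form u v) one"
proof -
  have "scale 2 (mult u v) = mult u v + mult u v"
    using scale_left_distrib[of 1 1 "mult u v"] by simp
  also have "\<dots> = (mult u v + mult v u) + commutator u v"
    by (simp add: commutator_def)
  also have "\<dots> = scale (- polar q u v + omega u v) one"
    using assms(2,3)
    by (simp add: anticommutator commutator_eq_omega one_perp_def scale_left_diff_distrib)
  also have "- polar q u v + omega u v = 2 * - B_form u v"
    using assms(1) by (simp add: B_form_def diff_divide_distrib)
  finally have "scale 2 (mult u v) = scale 2 (scale (- B_form u v) one)"
    by simp
  then show ?thesis
    using assms(1) by (simp only: scale_cancel_left simp_thms)
qed

lemma mult_decomposed:
  assumes "(2 :: 'f) \<noteq> 0" and "u \<in> one_perp" and "v \<in> one_perp"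
  shows "mult (scale \<alpha> one + u) (scale \<beta> one + v) =
    scale (\<alpha> * \<beta> - B_form u v) one + (scale \<alpha> v + scale \<beta> u)"
  using mult_one_perp[OF assms]
  by (simp add: mult_linear mult_one_left mult_one_right algebra_simps)

end

section \<open>The Vidinli algebra of a bilinear form\<close>

lemma vector_space_sum_scale:
  assumes "vector_space smul"
  shows "vector_space (sum_scale smul)"
proof -
  interpret vector_space smul by (rule assms)
  show ?thesis
    by unfold_locales
      (auto simp: sum_scale_Pair[OF assms] scale_right_distrib scale_left_distrib algebra_simps)
qed

lemma polar_sum_norm:
  assumes "bilinear_form smul B"
  shows "polar (sum_norm B) (\<alpha>, u) (\<beta>, v) = 2 * \<alpha> * \<beta> + B u v + B v u"
  using assms unfolding bilinear_map_iff
  by (simp add: polar_def power2_eq_square algebra_simps)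

lemma quadratic_form_sum_norm:
  assumes "bilinear_form smul B"
  shows "quadratic_form (sum_scale smul) (sum_norm B)"
proof -
  have vs: "vector_space smul"
    using assms unfolding bilinear_map_iff by blast
  show ?thesis
    unfolding quadratic_form_def bilinear_map_iff
    using assms[unfolded bilinear_map_iff] vector_space_sum_scale[OF vs]
    by (auto simp: sum_scale_Pair[OF vs] polar_sum_norm[OF assms] power2_eq_square algebra_simps)
qed

lemma bilinear_map_sum_mult:
  assumes "bilinear_form smul B"
  shows "bilinear_map (sum_scale smul) (sum_scale smul) (sum_scale smul) (sum_mult smul B)"
proof -
  have vs: "vector_space smul"
    using assms unfolding bilinear_map_iff by blast
  interpret vector_space smul by (rule vs)
  show ?thesis
    unfolding bilinear_map_iff
    using assms[unfolded bilinear_map_iff] vector_space_sum_scale[OF vs]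
    by (auto simp: sum_scale_Pair[OF vs] scale_right_distrib scale_left_distrib algebra_simps)
qed

theorem vidinli_algebra_of_bilinear_form:
  assumes "bilinear_form smul B"
  shows "vidinli_algebra (sum_scale smul) (sum_mult smul B) sum_one (sum_norm B)"
proof -
  have vs: "vector_space smul"
    using assms unfolding bilinear_map_iff by blast
  interpret V: vector_space smul by (rule vs)
  interpret S: vector_space "sum_scale smul"
    by (rule vector_space_sum_scale[OF vs])
  have B_zero: "B 0 v = 0" "B v 0 = 0" for v
  proof -
    have "B (smul 0 0) v = 0 * B 0 v" "B v (smul 0 0) = 0 * B v 0"
      using assms unfolding bilinear_map_iff by blast+
    then show "B 0 v = 0" "B v 0 = 0" by simp_all
  qed
  have double: "smul (2 * \<alpha>) u = smul \<alpha> u + smul \<alpha> u" for \<alpha> u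
    unfolding mult_2 by (rule V.scale_left_distrib)
  interpret conic_algebra "sum_scale smul" "sum_mult smul B" sum_one "sum_norm B"
  proof unfold_locales
    show "bilinear_map (sum_scale smul) (sum_scale smul) (sum_scale smul) (sum_mult smul B)"
      by (rule bilinear_map_sum_mult[OF assms])
    show "quadratic_form (sum_scale smul) (sum_norm B)"
      by (rule quadratic_form_sum_norm[OF assms])
    show "sum_norm B sum_one = 1"
      by (simp add: sum_one_def B_zero)
    fix x :: "'a \<times> 'b"
    obtain \<alpha> u where x: "x = (\<alpha>, u)" by (cases x)
    show "sum_mult smul B sum_one x = x" "sum_mult smul B x sum_one = x"
      by (simp_all add: x sum_one_def B_zero)
    show "sum_mult smul B x x - sum_scale smul (polar (sum_norm B) x sum_one) x
        + sum_scale smul (sum_norm B x) sum_one = 0"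
      by (simp add: x sum_one_def polar_sum_norm[OF assms] sum_scale_Pair[OF vs] B_zero double
          power2_eq_square zero_prod_def)
  qed
  have "commutator x y \<in> S.span {sum_one}" for x y
  proof -
    obtain \<alpha> u \<beta> v where "x = (\<alpha>, u)" "y = (\<beta>, v)" by (cases x, cases y)
    then have "commutator x y = sum_scale smul (B v u - B u v) sum_one"
      by (simp add: commutator_def sum_one_def sum_scale_Pair[OF vs] algebra_simps)
    then show ?thesis
      unfolding S.span_singleton by (rule range_eqI)
  qed
  then have "S.span {commutator x y | x y. True} \<subseteq> S.span {sum_one}"
    by (intro S.span_minimal S.subspace_span) auto
  then show ?thesis
    by unfold_locales
qed

section \<open>The correspondence\<close>

theorem theorem3p1:
  assumes "CHAR('f::field) \<noteq> 2"
  shows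
    "(\<forall>(smul :: 'f \<Rightarrow> 'a::ab_group_add \<Rightarrow> 'a) mult one q.
        vidinli_algebra smul mult one q \<longrightarrow>
        (let V = conic_algebra.one_perp one q;
             B = vidinli_algebra.B_form smul mult one q
         in module.internal_direct_sum smul (module.span smul {one}) V \<and>
            (\<forall>\<alpha> \<beta>. \<forall>u\<in>V. \<forall>v\<in>V.
               mult (smul \<alpha> one + u) (smul \<beta> one + v) =
                 smul (\<alpha> * \<beta> - B u v) one + (smul \<alpha> v + smul \<beta> u)))) \<and>
     (\<forall>(smul :: 'f \<Rightarrow> 'v::ab_group_add \<Rightarrow> 'v) B.
        vector_space smul \<longrightarrow> bilinear_form smul B \<longrightarrow>
        vidinli_algebra (sum_scale smul) (sum_mult smul B) sum_one (sum_norm B))"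
proof (intro conjI allI impI)
  fix smul :: "'f \<Rightarrow> 'a \<Rightarrow> 'a" and mult one q
  assume "vidinli_algebra smul mult one q"
  then interpret vidinli_algebra smul mult one q .
  note two = two_neq_zero_if_CHAR_neq_2[OF assms]
  show "let V = conic_algebra.one_perp one q;
            B = vidinli_algebra.B_form smul mult one q
        in module.internal_direct_sum smul (module.span smul {one}) V \<and>
           (\<forall>\<alpha> \<beta>. \<forall>u\<in>V. \<forall>v\<in>V.
              mult (smul \<alpha> one + u) (smul \<beta> one + v) =
                smul (\<alpha> * \<beta> - B u v) one + (smul \<alpha> v + smul \<beta> u))"
    unfolding Let_def using one_perp_decomposition[OF two] mult_decomposed[OF two] by blast
next
  fix smul :: "'f \<Rightarrow> 'v \<Rightarrow> 'v" and B
  assume "bilinear_form smul B"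
  then show "vidinli_algebra (sum_scale smul) (sum_mult smul B) sum_one (sum_norm B)"
    by (rule vidinli_algebra_of_bilinear_form)
qed

end
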